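(* Let $V$ be a vector space, $f:V\to V$ a linear endomorphism, and $x\in V$ an eigenvector of $f$ of eigenvalue $\lambda\neq 0$. For $k\ge 0$ let $x^k\in T(V,f)$ be the word $x\ldots x$ with $k$ letters (so $x^0=\emptyset$), let $\mathbb{K}[x]$ be the subspace of $T(V,f)$ with basis $(x^k)_{k\ge 0}$, and let $\mathbb{K}[x]_+$ be the subspace with basis $(x^k)_{k\ge 1}$. Then for all $k,l\ge 0$, $$x^k\bullet x^l=\lambda\binom{k+l}{k-1}x^{k+l}$$ (with $\binom{l}{-1}=0$). Putting $y_k=\frac{(k+1)!}{\lambda}x^k$ for all $k\ge 0$, $(y_k)_{k\ge 0}$ is a basis of $\mathbb{K}[x]$ such that for all $k,l\ge 0$ with $k+l\geq 0$, $$y_k\bullet y_l=\frac{k(k+1)}{k+l+1}\,y_{k+l},\qquad [y_k,y_l]=(k-l)\,y_{k+l}.$$ Hence $\mathbb{K}[x]_+$ is isomorphic, as a Lie algebra, to the Faà di Bruno Lie algebra.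
   Context: $\mathbb{K}$ is a field of characteristic zero. For a vector space $V$, $T(V)=\bigoplus_{n\ge 0}V^{\otimes n}$ is spanned by words with letters in $V$; $\emptyset$ is the empty word; juxtaposition is concatenation. The shuffle product $\sqcup\!\sqcup$ is the bilinear product with unit $\emptyset$ and $xu\sqcup\!\sqcup yv=x(u\sqcup\!\sqcup yv)+y(xu\sqcup\!\sqcup v)$ for $x,y\in V$, $u,v\in T(V)$. The bilinear product $\bullet$ on $T(V)$ is defined by $\emptyset\bullet w'=0$ and $(xw)\bullet w'=x(w\bullet w')+f(x)(w\sqcup\!\sqcup w')$ for $x\in V$, $w,w'\in T(V)$. It is right pre-Lie, $T(V,f)$ denotes $T(V)$ with this product, and its Lie bracket is $[a,b]=a\bullet b-b\bullet a$. The Faà di Bruno Lie algebra is the Lie algebra with basis $(e_k)_{k\ge 1}$ and bracket $[e_k,e_l]=(k-l)e_{k+l}$. *)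

theory Defs
  imports Complex_Main "HOL-Library.Function_Algebras"
begin

section \<open>Function spaces and bases\<close>

definition fscale :: "'k::times \<Rightarrow> ('i \<Rightarrow> 'k) \<Rightarrow> 'i \<Rightarrow> 'k"
  where "fscale c g = (\<lambda>i. c * g i)"

interpretation fs: vector_space "fscale :: 'k::field \<Rightarrow> ('i \<Rightarrow> 'k) \<Rightarrow> 'i \<Rightarrow> 'k"
  by unfold_locales (auto simp: fscale_def fun_eq_iff algebra_simps)

definition is_basis_of :: "('k::field \<Rightarrow> 'a::ab_group_add \<Rightarrow> 'a) \<Rightarrow> 'i set \<Rightarrow> ('i \<Rightarrow> 'a) \<Rightarrow> 'a set \<Rightarrow> bool"
  where "is_basis_of scale I b S \<longleftrightarrow>
    inj_on b I \<and> \<not> module.dependent scale (b ` I) \<and> module.span scale (b ` I) = S"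

section \<open>The tensor space of a vector space\<close>

text \<open>
  \<open>multilinear scale (*) \<phi>\<close> says that \<open>\<phi>\<close>, a scalar function on lists of vectors, amounts to
  a sequence of multilinear forms, one in each number of variables. The word \<open>v\<^sub>1\<dots>v\<^sub>n\<close>, that is
  \<open>v\<^sub>1 \<otimes> \<dots> \<otimes> v\<^sub>n\<close>, is realised as evaluation of multilinear forms at \<open>(v\<^sub>1, \<dots>, v\<^sub>n)\<close>, and the tensor
  space is the span of all words. Over a field this is the tensor algebra: words are
  multilinear in their letters, and every multilinear map factors uniquely through them; see
  \<open>word_add\<close>, \<open>word_scale\<close>, \<open>tensor_universal\<close> and \<open>tensor_unique\<close> below.
\<close>

definition multilinear :: "('k::field \<Rightarrow> 'v::ab_group_add \<Rightarrow> 'v) \<Rightarrow> ('k \<Rightarrow> 'w::ab_group_add \<Rightarrow> 'w) \<Rightarrow>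
    ('v list \<Rightarrow> 'w) \<Rightarrow> bool"
  where "multilinear scale scale' \<phi> \<longleftrightarrow>
    (\<forall>p q. Vector_Spaces.linear scale scale' (\<lambda>v. \<phi> (p @ v # q)))"

type_synonym ('k, 'v) tensor = "('v list \<Rightarrow> 'k) \<Rightarrow> 'k"

definition word :: "('k::field \<Rightarrow> 'v::ab_group_add \<Rightarrow> 'v) \<Rightarrow> 'v list \<Rightarrow> ('k, 'v) tensor"
  where "word scale ws = (\<lambda>\<phi>. if multilinear scale (*) \<phi> then \<phi> ws else 0)"

definition tensor_space :: "('k::field \<Rightarrow> 'v::ab_group_add \<Rightarrow> 'v) \<Rightarrow> ('k, 'v) tensor set"
  where "tensor_space scale = fs.span (range (word scale))"

section \<open>The shuffle product and the pre-Lie product\<close>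

text \<open>
  On words, both products are sums of words without coefficients; they are given first as the lists
  of their summands. \<open>bilinear_extension\<close> extends them bilinearly to the tensor space, using that
  \<open>a \<in> T(V)\<close> acts on a multilinear form by extending the form linearly from words to \<open>a\<close>. The defining
  recursions and the bilinearity are \<open>shuffle_prod_unit\<close>, \<open>shuffle_prod_recursion\<close>,
  \<open>prelie_prod_recursion\<close>, \<open>bilinear_extension_left\<close>, \<open>shuffle_prod_right\<close> and \<open>prelie_prod_right\<close>.
\<close>

fun shuffle_words :: "'v list \<Rightarrow> 'v list \<Rightarrow> 'v list list"
  where
    "shuffle_words [] v = [v]"
  | "shuffle_words (x # u) [] = [x # u]"
  | "shuffle_words (x # u) (y # v) =
       map ((#) x) (shuffle_words u (y # v)) @ map ((#) y) (shuffle_words (x # u) v)"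

fun prelie_words :: "('v \<Rightarrow> 'v) \<Rightarrow> 'v list \<Rightarrow> 'v list \<Rightarrow> 'v list list"
  where
    "prelie_words f [] w' = []"
  | "prelie_words f (x # w) w' =
       map ((#) x) (prelie_words f w w') @ map ((#) (f x)) (shuffle_words w w')"

definition bilinear_extension :: "('k::field \<Rightarrow> 'v::ab_group_add \<Rightarrow> 'v) \<Rightarrow>
    ('v list \<Rightarrow> 'v list \<Rightarrow> 'v list list) \<Rightarrow> ('k, 'v) tensor \<Rightarrow> ('k, 'v) tensor \<Rightarrow> ('k, 'v) tensor"
  where "bilinear_extension scale P a b =
    (\<lambda>\<phi>. if multilinear scale (*) \<phi> then a (\<lambda>u. b (\<lambda>v. \<Sum>w\<leftarrow>P u v. \<phi> w)) else 0)"

definition shuffle_prod :: "('k::field \<Rightarrow> 'v::ab_group_add \<Rightarrow> 'v) \<Rightarrow>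
    ('k, 'v) tensor \<Rightarrow> ('k, 'v) tensor \<Rightarrow> ('k, 'v) tensor"
  where "shuffle_prod scale = bilinear_extension scale shuffle_words"

definition prelie_prod :: "('k::field \<Rightarrow> 'v::ab_group_add \<Rightarrow> 'v) \<Rightarrow> ('v \<Rightarrow> 'v) \<Rightarrow>
    ('k, 'v) tensor \<Rightarrow> ('k, 'v) tensor \<Rightarrow> ('k, 'v) tensor"
  where "prelie_prod scale f = bilinear_extension scale (prelie_words f)"

definition prelie_bracket :: "('k::field \<Rightarrow> 'v::ab_group_add \<Rightarrow> 'v) \<Rightarrow> ('v \<Rightarrow> 'v) \<Rightarrow>
    ('k, 'v) tensor \<Rightarrow> ('k, 'v) tensor \<Rightarrow> ('k, 'v) tensor"
  where "prelie_bracket scale f a b = prelie_prod scale f a b - prelie_prod scale f b a"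

text \<open>Concatenation of a letter on the left.\<close>

definition letter_cons :: "('k::field \<Rightarrow> 'v::ab_group_add \<Rightarrow> 'v) \<Rightarrow> 'v \<Rightarrow>
    ('k, 'v) tensor \<Rightarrow> ('k, 'v) tensor"
  where "letter_cons scale x a = (\<lambda>\<phi>. if multilinear scale (*) \<phi> then a (\<lambda>u. \<phi> (x # u)) else 0)"

definition power_word :: "('k::field \<Rightarrow> 'v::ab_group_add \<Rightarrow> 'v) \<Rightarrow> 'v \<Rightarrow> nat \<Rightarrow> ('k, 'v) tensor"
  where "power_word scale x k = word scale (replicate k x)"

definition scaled_power_word :: "('k::field_char_0 \<Rightarrow> 'v::ab_group_add \<Rightarrow> 'v) \<Rightarrow> 'k \<Rightarrow> 'v \<Rightarrow> nat \<Rightarrow>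
    ('k, 'v) tensor"
  where "scaled_power_word scale lam x k = fscale (fact (k + 1) / lam) (power_word scale x k)"

section \<open>Lie algebras\<close>

definition lie_algebra_on :: "('k::field \<Rightarrow> 'a::ab_group_add \<Rightarrow> 'a) \<Rightarrow> 'a set \<Rightarrow> ('a \<Rightarrow> 'a \<Rightarrow> 'a) \<Rightarrow> bool"
  where "lie_algebra_on scale S br \<longleftrightarrow>
    vector_space scale \<and> module.subspace scale S \<and>
    (\<forall>a\<in>S. \<forall>b\<in>S. br a b \<in> S) \<and>
    (\<forall>a\<in>S. \<forall>b\<in>S. \<forall>c\<in>S. br (a + b) c = br a c + br b c \<and> br c (a + b) = br c a + br c b) \<and>
    (\<forall>t. \<forall>a\<in>S. \<forall>b\<in>S. br (scale t a) b = scale t (br a b) \<and> br a (scale t b) = scale t (br a b)) \<and>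
    (\<forall>a\<in>S. br a a = 0) \<and>
    (\<forall>a\<in>S. \<forall>b\<in>S. \<forall>c\<in>S. br a (br b c) + br b (br c a) + br c (br a b) = 0)"

definition lie_isomorphic :: "('k::field \<Rightarrow> 'a::ab_group_add \<Rightarrow> 'a) \<Rightarrow> 'a set \<Rightarrow> ('a \<Rightarrow> 'a \<Rightarrow> 'a) \<Rightarrow>
    ('k \<Rightarrow> 'b::ab_group_add \<Rightarrow> 'b) \<Rightarrow> 'b set \<Rightarrow> ('b \<Rightarrow> 'b \<Rightarrow> 'b) \<Rightarrow> bool"
  where "lie_isomorphic scale S br scale' S' br' \<longleftrightarrow>
    lie_algebra_on scale S br \<and> lie_algebra_on scale' S' br' \<and>
    (\<exists>\<phi>. bij_betw \<phi> S S' \<and>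
      (\<forall>a\<in>S. \<forall>b\<in>S. \<phi> (a + b) = \<phi> a + \<phi> b) \<and>
      (\<forall>t. \<forall>a\<in>S. \<phi> (scale t a) = scale' t (\<phi> a)) \<and>
      (\<forall>a\<in>S. \<forall>b\<in>S. \<phi> (br a b) = br' (\<phi> a) (\<phi> b)))"

text \<open>
  The Faa di Bruno Lie algebra: the underlying space consists of the finitely supported functions on the positive integers,
  and the bracket is the bilinear extension of \<open>[e\<^sub>k, e\<^sub>l] = (k - l) e\<^bsub>k + l\<^esub>\<close> written as a convolution;
  see \<open>fdb_basis\<close> and \<open>fdb_bracket_e\<close>.
\<close>

definition fdb_e :: "nat \<Rightarrow> nat \<Rightarrow> 'k::field"
  where "fdb_e k = (\<lambda>n. if n = k then 1 else 0)"

definition faa_di_bruno :: "(nat \<Rightarrow> 'k::field) set"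
  where "faa_di_bruno = fs.span (fdb_e ` {1..})"

definition fdb_bracket :: "(nat \<Rightarrow> 'k::field) \<Rightarrow> (nat \<Rightarrow> 'k) \<Rightarrow> nat \<Rightarrow> 'k"
  where "fdb_bracket g h = (\<lambda>n. \<Sum>k\<le>n. (of_nat k - of_nat (n - k)) * (g k * h (n - k)))"

lemma fdb_bracket_e:
  "fdb_bracket (fdb_e k) (fdb_e l) = fscale (of_nat k - of_nat l) (fdb_e (k + l) :: nat \<Rightarrow> 'k::field)"
proof
  fix n
  have "fdb_bracket (fdb_e k) (fdb_e l) n =
      (\<Sum>i\<le>n. if i = k then (if n - k = l then (of_nat k - of_nat l :: 'k) else 0) else 0)"
    unfolding fdb_bracket_def fdb_e_def by (rule sum.cong) auto
  also have "\<dots> = (if k \<le> n \<and> n - k = l then of_nat k - of_nat l else 0)"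
    by (subst sum.delta) auto
  also have "\<dots> = fscale (of_nat k - of_nat l) (fdb_e (k + l)) n"
    by (auto simp: fscale_def fdb_e_def)
  finally show "fdb_bracket (fdb_e k) (fdb_e l) n = fscale (of_nat k - of_nat l) (fdb_e (k + l) :: nat \<Rightarrow> 'k) n" .
qed

lemma fdb_basis: "is_basis_of fscale {1..} fdb_e (faa_di_bruno :: (nat \<Rightarrow> 'k::field) set)"
proof -
  have inj: "inj_on (fdb_e :: nat \<Rightarrow> nat \<Rightarrow> 'k) {1..}"
    by (auto simp: inj_on_def fdb_e_def fun_eq_iff split: if_splits)
  have "fs.independent ((fdb_e :: nat \<Rightarrow> nat \<Rightarrow> 'k) ` {1..})"
  proof (subst fs.independent_explicit_module, intro allI impI)
    fix t u and v :: "nat \<Rightarrow> 'k"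
    assume t: "finite t" "t \<subseteq> fdb_e ` {1..}" and z: "(\<Sum>v\<in>t. fscale (u v) v) = 0" and v: "v \<in> t"
    obtain k where k: "v = fdb_e k" using t v by auto
    have "u w * w k = (if w = v then u v else 0)" if w: "w \<in> t" for w
    proof -
      obtain j where j: "w = fdb_e j" using t w by auto
      show ?thesis
        by (cases "j = k") (auto simp: j k fdb_e_def fun_eq_iff)
    qed
    then have "(\<Sum>w\<in>t. u w * w k) = (\<Sum>w\<in>t. if w = v then u v else 0)"
      by (rule sum.cong[OF refl])
    moreover have "(\<Sum>v\<in>t. fscale (u v) v) k = (\<Sum>w\<in>t. u w * w k)"
      using t(1) by (induction t rule: finite_induct) (auto simp: fscale_def)
    ultimately have "(\<Sum>v\<in>t. fscale (u v) v) k = (\<Sum>w\<in>t. if w = v then u v else 0)"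
      by simp
    then show "u v = 0" using z t v by (simp add: sum.delta)
  qed
  with inj show ?thesis
    by (simp add: is_basis_of_def faa_di_bruno_def)
qed

section \<open>Adequacy of the encoding\<close>

context vector_space
begin

lemma word_add: "word scale (p @ (v + w) # q) = word scale (p @ v # q) + word scale (p @ w # q)"
  by (auto simp: word_def fun_eq_iff multilinear_def Vector_Spaces.linear_iff)

lemma word_scale: "word scale (p @ scale c v # q) = fscale c (word scale (p @ v # q))"
  by (auto simp: word_def fun_eq_iff multilinear_def Vector_Spaces.linear_iff fscale_def)

lemma tensor_universal:
  fixes scale' :: "'a \<Rightarrow> 'w::ab_group_add \<Rightarrow> 'w"
  assumes W: "vector_space scale'" and ml: "multilinear scale scale' \<psi>"
  shows "\<exists>g. Vector_Spaces.linear fscale scale' g \<and> (\<forall>u. g (word scale u) = \<psi> u)"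
proof -
  interpret W: vector_space scale' by fact
  interpret TW: vector_space_pair "fscale :: 'a \<Rightarrow> ('a, 'b) tensor \<Rightarrow> _" scale' by unfold_locales
  have K: "vector_space ((*) :: 'a \<Rightarrow> 'a \<Rightarrow> 'a)"
    by unfold_locales (auto simp: algebra_simps)
  interpret WK: vector_space_pair scale' "(*) :: 'a \<Rightarrow> 'a \<Rightarrow> 'a"
    using W K by (rule vector_space_pair.intro)
  interpret TK: vector_space_pair "fscale :: 'a \<Rightarrow> ('a, 'b) tensor \<Rightarrow> _" "(*) :: 'a \<Rightarrow> 'a \<Rightarrow> 'a"
    by (rule vector_space_pair.intro[OF fs.vector_space_axioms K])
  obtain B where B: "B \<subseteq> range (word scale)" "fs.independent B" "range (word scale) \<subseteq> fs.span B"
    using fs.maximal_independent_subset by blast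
  obtain g where g: "Vector_Spaces.linear fscale scale' g" "\<And>b. b \<in> B \<Longrightarrow> g b = \<psi> (inv (word scale) b)"
    using TW.linear_independent_extend[OF B(2), of "\<lambda>b. \<psi> (inv (word scale) b)"] by blast
  have "g (word scale u) = \<psi> u" for u
  proof (rule ccontr)
    assume "g (word scale u) \<noteq> \<psi> u"
    then have "W.independent {g (word scale u) - \<psi> u}"
      by simp
    from WK.linear_independent_extend[OF this, of "\<lambda>_. 1"] obtain l
      where l: "Vector_Spaces.linear scale' (*) l" "l (g (word scale u) - \<psi> u) = 1" by auto
    have ml': "multilinear scale (*) (\<lambda>w. l (\<psi> w))"
      using ml l(1) K by (auto simp: multilinear_def Vector_Spaces.linear_iff)
    have "l (g (word scale u)) = word scale u (\<lambda>w. l (\<psi> w))"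
    proof (rule TK.linear_eq_on[where f = "\<lambda>a. l (g a)" and g = "\<lambda>a. a (\<lambda>w. l (\<psi> w))"])
      show "Vector_Spaces.linear fscale (*) (\<lambda>a. l (g a))"
        using l(1) g(1) by (auto simp: Vector_Spaces.linear_iff)
      show "Vector_Spaces.linear fscale (*) (\<lambda>a :: ('a, 'b) tensor. a (\<lambda>w. l (\<psi> w)))"
        using K fs.vector_space_axioms by (auto simp: Vector_Spaces.linear_iff fscale_def)
      show "word scale u \<in> fs.span B" using B(3) by auto
      fix b assume b: "b \<in> B"
      then have "b = word scale (inv (word scale) b)"
        using B(1) by (metis f_inv_into_f subsetD)
      then have "b (\<lambda>w. l (\<psi> w)) = l (\<psi> (inv (word scale) b))"
        using ml' by (metis word_def)
      then show "l (g b) = b (\<lambda>w. l (\<psi> w))"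
        using g(2)[OF b] by simp
    qed
    also have "\<dots> = l (\<psi> u)" using ml' by (simp add: word_def)
    finally have "l (g (word scale u) - \<psi> u) = 0"
      using l(1) by (metis WK.linear_diff diff_self)
    with l(2) show False by simp
  qed
  with g(1) show ?thesis by blast
qed

lemma tensor_unique:
  assumes "Vector_Spaces.linear fscale scale' g" "Vector_Spaces.linear fscale scale' h"
    and "\<And>u. g (word scale u) = h (word scale u)" and "a \<in> tensor_space scale"
  shows "g a = h a"
proof -
  interpret vector_space_pair "fscale :: 'a \<Rightarrow> ('a, 'b) tensor \<Rightarrow> _" scale'
    using assms(1) by (auto simp: Vector_Spaces.linear_iff vector_space_pair_def)
  show ?thesis
    using assms linear_eq_on[of g h a "range (word scale)"] by (auto simp: tensor_space_def)
qed


lemma multilinear_cons: "multilinear scale (*) \<phi> \<Longrightarrow> multilinear scale (*) (\<lambda>u. \<phi> (x # u))"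
  unfolding multilinear_def by (simp flip: append_Cons)

lemma linear_form_add:
  assumes "Vector_Spaces.linear scale (*) g" "Vector_Spaces.linear scale (*) h"
  shows "Vector_Spaces.linear scale (*) (\<lambda>v. g v + h v :: 'a)"
  using assms by (auto simp: Vector_Spaces.linear_iff algebra_simps)

lemma field_vector_space: "vector_space ((*) :: 'a \<Rightarrow> 'a \<Rightarrow> 'a)"
  by unfold_locales (auto simp: algebra_simps)

lemma linear_form_scale:
  assumes "Vector_Spaces.linear scale (*) g"
  shows "Vector_Spaces.linear scale (*) (\<lambda>v. c * g v :: 'a)"
  using assms by (auto simp: Vector_Spaces.linear_iff algebra_simps)

lemma linear_form_zero: "Vector_Spaces.linear scale (*) (\<lambda>_. 0 :: 'a)"
  using field_vector_space vector_space_axioms by (auto simp: Vector_Spaces.linear_iff)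

lemma linear_form_sum_list:
  assumes "multilinear scale (*) (\<phi> :: 'b list \<Rightarrow> 'a)"
  shows "Vector_Spaces.linear scale (*) (\<lambda>v. \<Sum>w\<leftarrow>ws. \<phi> (v # w))"
proof (induction ws)
  case Nil
  show ?case using linear_form_zero by simp
next
  case (Cons w ws)
  have "Vector_Spaces.linear scale (*) (\<lambda>v. \<phi> (v # w))"
    using assms[unfolded multilinear_def, rule_format, of "[]" w] by simp
  from linear_form_add[OF this Cons.IH] show ?case by simp
qed

lemma shuffle_words_commute:
  fixes \<phi> :: "'b list \<Rightarrow> 'a"
  shows "(\<Sum>w\<leftarrow>shuffle_words u v. \<phi> w) = (\<Sum>w\<leftarrow>shuffle_words v u. \<phi> w)"
proof (induction u v arbitrary: \<phi> rule: shuffle_words.induct)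
  case (1 v)
  then show ?case by (cases v) auto
next
  case (3 x u y v)
  from 3(1)[of "\<lambda>w. \<phi> (x # w)"] 3(2)[of "\<lambda>w. \<phi> (y # w)"] show ?case
    by (simp add: o_def add.commute)
qed auto

lemma linear_shuffle_words:
  assumes "multilinear scale (*) (\<phi> :: 'b list \<Rightarrow> 'a)"
  shows "Vector_Spaces.linear scale (*) (\<lambda>t. \<Sum>w\<leftarrow>shuffle_words (p @ t # q) v. \<phi> w)"
  using assms
proof (induction "length p + length v" arbitrary: p v \<phi> rule: less_induct)
  case less
  show ?case
  proof (cases v)
    case Nil
    have "shuffle_words u [] = [u]" for u :: "'b list" by (cases u) auto
    then show ?thesis using less.prems Nil by (simp add: multilinear_def)
  next
    case (Cons y v')
    show ?thesis
    proof (cases p)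
      case Nil
      have 1: "Vector_Spaces.linear scale (*)
          (\<lambda>t. \<Sum>w\<leftarrow>shuffle_words ([] @ t # q) v'. \<phi> (y # w))"
        by (rule less.hyps) (use Cons Nil multilinear_cons less.prems in auto)
      show ?thesis
        using linear_form_add[OF linear_form_sum_list[OF less.prems] 1] Nil Cons by (simp add: o_def)
    next
      case (Cons x p')
      have 1: "Vector_Spaces.linear scale (*)
          (\<lambda>t. \<Sum>w\<leftarrow>shuffle_words (p' @ t # q) (y # v'). \<phi> (x # w))"
        by (rule less.hyps) (use \<open>v = y # v'\<close> Cons multilinear_cons less.prems in auto)
      have 2: "Vector_Spaces.linear scale (*)
          (\<lambda>t. \<Sum>w\<leftarrow>shuffle_words (p @ t # q) v'. \<phi> (y # w))"
        by (rule less.hyps) (use \<open>v = y # v'\<close> Cons multilinear_cons less.prems in auto)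
      show ?thesis
        using linear_form_add[OF 1 2] Cons \<open>v = y # v'\<close> by (simp add: o_def)
    qed
  qed
qed

lemma multilinear_shuffle_words:
  assumes "multilinear scale (*) (\<phi> :: 'b list \<Rightarrow> 'a)"
  shows "multilinear scale (*) (\<lambda>u. \<Sum>w\<leftarrow>shuffle_words u v. \<phi> w)"
    and "multilinear scale (*) (\<lambda>v. \<Sum>w\<leftarrow>shuffle_words u v. \<phi> w)"
  using linear_shuffle_words[OF assms] shuffle_words_commute[of \<phi> u]
  by (simp_all add: multilinear_def)

lemma multilinear_prelie_words_right:
  assumes "multilinear scale (*) (\<phi> :: 'b list \<Rightarrow> 'a)"
  shows "multilinear scale (*) (\<lambda>v. \<Sum>w\<leftarrow>prelie_words f u v. \<phi> w)"
  using assms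
proof (induction u arbitrary: \<phi>)
  case Nil
  show ?case using linear_form_zero by (simp add: multilinear_def)
next
  case (Cons x u)
  from Cons.IH[OF multilinear_cons[OF Cons.prems, of x]]
    multilinear_shuffle_words(2)[OF multilinear_cons[OF Cons.prems, of "f x"], of u]
  show ?case by (simp add: multilinear_def o_def linear_form_add)
qed

lemma multilinear_prelie_words_left:
  assumes "multilinear scale (*) (\<phi> :: 'b list \<Rightarrow> 'a)" and f: "Vector_Spaces.linear scale scale f"
  shows "multilinear scale (*) (\<lambda>u. \<Sum>w\<leftarrow>prelie_words f u v. \<phi> w)"
proof -
  have "Vector_Spaces.linear scale (*) (\<lambda>t. \<Sum>w\<leftarrow>prelie_words f (p @ t # q) v. \<phi> w)" for p q
    using assms(1)
  proof (induction p arbitrary: \<phi>)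
    case Nil
    have "Vector_Spaces.linear scale (*) (\<lambda>t. \<Sum>w\<leftarrow>shuffle_words q v. \<phi> (f t # w))"
      using linear_form_sum_list[OF Nil.prems, of "shuffle_words q v"] f
      by (auto simp: Vector_Spaces.linear_iff)
    from linear_form_add[OF linear_form_sum_list[OF Nil.prems] this]
    show ?case by (simp add: o_def)
  next
    case (Cons x p)
    from linear_form_add[OF Cons.IH[OF multilinear_cons[OF Cons.prems, of x]]
      linear_shuffle_words[OF multilinear_cons[OF Cons.prems, of "f x"], of p q v]]
    show ?case by (simp add: o_def)
  qed
  then show ?thesis by (simp add: multilinear_def)
qed

lemma tensor_induct [consumes 1, case_names word zero add scale]:
  assumes "a \<in> tensor_space scale" and "\<And>u. P (word scale u)" and "P 0"
    and "\<And>a b. P a \<Longrightarrow> P b \<Longrightarrow> P (a + b)" and "\<And>c a. P a \<Longrightarrow> P (fscale c a)"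
  shows "P a"
  using assms(1) unfolding tensor_space_def
proof (induction rule: fs.span_induct)
  case base
  show ?case using assms by (auto simp: fs.subspace_def)
next
  case (step x)
  then show ?case using assms by auto
qed

lemma tensor_form_add:
  assumes "a \<in> tensor_space scale" "multilinear scale (*) \<phi>" "multilinear scale (*) \<psi>"
  shows "a (\<lambda>u. \<phi> u + \<psi> u) = a \<phi> + a \<psi>"
proof -
  have "multilinear scale (*) (\<lambda>u. \<phi> u + \<psi> u)"
    using assms(2,3) by (simp add: multilinear_def linear_form_add)
  with assms show ?thesis
    by (induction rule: tensor_induct) (auto simp: word_def fscale_def algebra_simps)
qed

lemma tensor_form_scale:
  assumes "a \<in> tensor_space scale" "multilinear scale (*) \<phi>"
  shows "a (\<lambda>u. c * \<phi> u) = c * a \<phi>"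
proof -
  have "multilinear scale (*) (\<lambda>u. c * \<phi> u)"
    using assms(2) by (simp add: multilinear_def linear_form_scale)
  with assms show ?thesis
    by (induction rule: tensor_induct) (auto simp: word_def fscale_def algebra_simps)
qed

lemma tensor_form_multilinear:
  assumes "b \<in> tensor_space scale"
    and "\<And>v. multilinear scale (*) (\<lambda>u. F u v)" and "\<And>u. multilinear scale (*) (F u)"
  shows "multilinear scale (*) (\<lambda>u. b (F u))"
  using assms(1)
proof (induction rule: tensor_induct)
  case (word u)
  show ?case using assms(2,3) by (simp add: word_def)
next
  case zero
  show ?case by (simp add: multilinear_def linear_form_zero)
next
  case (add a b)
  then show ?case by (simp add: multilinear_def linear_form_add)
next
  case (scale c a)
  then show ?case by (simp add: multilinear_def fscale_def linear_form_scale)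
qed

lemma letter_cons_word: "letter_cons scale x (word scale u) = word scale (x # u)"
  by (auto simp: letter_cons_def word_def multilinear_cons fun_eq_iff)

lemma bilinear_extension_left:
  "bilinear_extension scale P (a + a') b = bilinear_extension scale P a b + bilinear_extension scale P a' b"
  "bilinear_extension scale P (fscale c a) b = fscale c (bilinear_extension scale P a b)"
  by (auto simp: bilinear_extension_def fscale_def fun_eq_iff)

lemma shuffle_prod_right:
  assumes "a \<in> tensor_space scale" "b \<in> tensor_space scale" "b' \<in> tensor_space scale"
  shows "shuffle_prod scale a (b + b') = shuffle_prod scale a b + shuffle_prod scale a b'"
    and "shuffle_prod scale a (fscale c b) = fscale c (shuffle_prod scale a b)"
proof -
  have m: "multilinear scale (*) (\<lambda>u. b (\<lambda>v. \<Sum>w\<leftarrow>shuffle_words u v. \<phi> w))"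
    if "multilinear scale (*) \<phi>" "b \<in> tensor_space scale" for \<phi> and b :: "('a, 'b) tensor"
    using that by (intro tensor_form_multilinear[of b "\<lambda>u v. \<Sum>w\<leftarrow>shuffle_words u v. \<phi> w"]
        multilinear_shuffle_words)
  from assms show "shuffle_prod scale a (b + b') = shuffle_prod scale a b + shuffle_prod scale a b'"
    and "shuffle_prod scale a (fscale c b) = fscale c (shuffle_prod scale a b)"
    by (auto simp: shuffle_prod_def bilinear_extension_def fscale_def fun_eq_iff
        intro!: tensor_form_add tensor_form_scale m)
qed

lemma prelie_prod_right:
  assumes "Vector_Spaces.linear scale scale f"
    and "a \<in> tensor_space scale" "b \<in> tensor_space scale" "b' \<in> tensor_space scale"
  shows "prelie_prod scale f a (b + b') = prelie_prod scale f a b + prelie_prod scale f a b'"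
    and "prelie_prod scale f a (fscale c b) = fscale c (prelie_prod scale f a b)"
proof -
  have m: "multilinear scale (*) (\<lambda>u. b (\<lambda>v. \<Sum>w\<leftarrow>prelie_words f u v. \<phi> w))"
    if "multilinear scale (*) \<phi>" "b \<in> tensor_space scale" for \<phi> and b :: "('a, 'b) tensor"
    using that by (intro tensor_form_multilinear[of b "\<lambda>u v. \<Sum>w\<leftarrow>prelie_words f u v. \<phi> w"]
        multilinear_prelie_words_left multilinear_prelie_words_right assms(1))
  from assms show "prelie_prod scale f a (b + b') = prelie_prod scale f a b + prelie_prod scale f a b'"
    and "prelie_prod scale f a (fscale c b) = fscale c (prelie_prod scale f a b)"
    by (auto simp: prelie_prod_def bilinear_extension_def fscale_def fun_eq_iff
        intro!: tensor_form_add tensor_form_scale m)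
qed

lemma shuffle_prod_unit:
  assumes "a \<in> tensor_space scale"
  shows "shuffle_prod scale (word scale []) a = a" and "shuffle_prod scale a (word scale []) = a"
proof -
  have nil: "shuffle_words u [] = [u]" for u :: "'b list" by (cases u) auto
  have a: "a \<phi> = 0" if "\<not> multilinear scale (*) \<phi>" for \<phi>
    using assms that by (induction rule: tensor_induct) (auto simp: word_def fscale_def)
  show "shuffle_prod scale (word scale []) a = a"
  proof
    fix \<phi>
    show "shuffle_prod scale (word scale []) a \<phi> = a \<phi>"
      using multilinear_shuffle_words(1) a
        tensor_form_multilinear[OF assms, of "\<lambda>u v. \<Sum>w\<leftarrow>shuffle_words u v. \<phi> w"]
        multilinear_shuffle_words(2)
      by (cases "multilinear scale (*) \<phi>")
        (simp_all add: shuffle_prod_def bilinear_extension_def, simp add: word_def)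
  qed
  show "shuffle_prod scale a (word scale []) = a"
  proof
    fix \<phi>
    show "shuffle_prod scale a (word scale []) \<phi> = a \<phi>"
      using a multilinear_shuffle_words(2)
      by (cases "multilinear scale (*) \<phi>")
        (simp_all add: shuffle_prod_def bilinear_extension_def word_def nil)
  qed
qed

lemma shuffle_prod_word:
  "shuffle_prod scale (word scale u) (word scale v) = (\<Sum>w\<leftarrow>shuffle_words u v. word scale w)"
proof
  fix \<phi>
  have "(\<Sum>w\<leftarrow>ws. word scale w) \<phi> = (\<Sum>w\<leftarrow>ws. word scale w \<phi>)" for ws
    by (induction ws) auto
  then show "shuffle_prod scale (word scale u) (word scale v) \<phi> = (\<Sum>w\<leftarrow>shuffle_words u v. word scale w) \<phi>"
    by (simp add: shuffle_prod_def bilinear_extension_def word_def multilinear_shuffle_words)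
qed

lemma prelie_prod_word:
  assumes "Vector_Spaces.linear scale scale f"
  shows "prelie_prod scale f (word scale u) (word scale v) = (\<Sum>w\<leftarrow>prelie_words f u v. word scale w)"
proof
  fix \<phi>
  have "(\<Sum>w\<leftarrow>ws. word scale w) \<phi> = (\<Sum>w\<leftarrow>ws. word scale w \<phi>)" for ws
    by (induction ws) auto
  then show "prelie_prod scale f (word scale u) (word scale v) \<phi> = (\<Sum>w\<leftarrow>prelie_words f u v. word scale w) \<phi>"
    using assms by (simp add: prelie_prod_def bilinear_extension_def word_def
        multilinear_prelie_words_left multilinear_prelie_words_right)
qed

lemma letter_cons_sum_list:
  "letter_cons scale x (\<Sum>w\<leftarrow>ws. word scale w) = (\<Sum>w\<leftarrow>ws. word scale (x # w))"
proof (induction ws)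
  case Nil
  show ?case by (simp add: letter_cons_def fun_eq_iff)
next
  case (Cons w ws)
  have add: "letter_cons scale x (a + b) = letter_cons scale x a + letter_cons scale x b" for a b
    by (simp add: letter_cons_def fun_eq_iff)
  show ?case by (simp only: list.map sum_list.Cons add letter_cons_word Cons.IH)
qed

lemma shuffle_prod_recursion:
  "shuffle_prod scale (word scale (x # u)) (word scale (y # v)) =
     letter_cons scale x (shuffle_prod scale (word scale u) (word scale (y # v))) +
     letter_cons scale y (shuffle_prod scale (word scale (x # u)) (word scale v))"
  by (simp add: shuffle_prod_word letter_cons_sum_list o_def)

lemma prelie_prod_recursion:
  assumes "Vector_Spaces.linear scale scale f"
  shows "prelie_prod scale f (word scale []) (word scale v) = 0"
    and "prelie_prod scale f (word scale (x # u)) (word scale v) =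
      letter_cons scale x (prelie_prod scale f (word scale u) (word scale v)) +
      letter_cons scale (f x) (shuffle_prod scale (word scale u) (word scale v))"
  using assms by (simp_all add: prelie_prod_word shuffle_prod_word letter_cons_sum_list o_def)

end

end

theory Submission
  imports Defs
begin

text \<open>
  Every word occurring in \<open>x\<^sup>k \<bullet> x\<^sup>l\<close> is \<open>x\<^sup>k\<^sup>+\<^sup>l\<close> with one letter replaced by \<open>f x = \<lambda>x\<close>, so
  the product is a multiple of \<open>x\<^sup>k\<^sup>+\<^sup>l\<close> and only the number of summands has to be found. The shuffles
  of \<open>x\<^sup>k\<close> and \<open>x\<^sup>l\<close> number \<open>k + l\<close> choose \<open>k\<close>, and the defining recursion of \<open>\<bullet>\<close> then turns the count
  for \<open>\<bullet>\<close> into Pascal's rule (\<open>sum_list_shuffle_words_power\<close>, \<open>sum_list_prelie_words_power\<close>).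
  After the rescaling by \<open>(k+1)!/\<lambda>\<close> the coefficient is \<open>k(k+1)/(k+l+1)\<close>, and the bracket follows from
  \<open>k(k+1) - l(l+1) = (k-l)(k+l+1)\<close>.

  Linear independence comes from dual functionals. Since \<open>x \<noteq> 0\<close>, there is a linear form \<open>g\<close>
  with \<open>g x = 1\<close>; the multilinear form \<open>power_form g k\<close>, which is \<open>g \<otimes> \<dots> \<otimes> g\<close> in degree \<open>k\<close> and \<open>0\<close> in all
  other degrees, takes the value \<open>1\<close> at \<open>x\<^sup>k\<close> and \<open>0\<close> at the other powers.

  The same functionals, rescaled, are the coordinates of a linear map defined on all functionals on
  forms, which sends \<open>y\<^sub>k\<close> to \<open>e\<^sub>k\<close>. It restricts to a bijection from \<open>K[x]\<^sub>+\<close> onto the Faa di Bruno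
  algebra, and it respects brackets because it does so on the \<open>y\<^sub>k\<close>. The Lie axioms are verified only for
  the Faa di Bruno algebra, where the Jacobi identity can be read off from basis elements; injectivity
  carries them back to \<open>K[x]\<^sub>+\<close> (\<open>lie_isomorphic_if_bracket_hom\<close>).
\<close>

section \<open>Bases of function spaces\<close>

text \<open>
  On a space of functions, evaluation at a point is a linear functional. This covers tensors: a
  tensor is a function on forms, so forms dual to a family of tensors serve as the points \<open>p j\<close>.
\<close>

lemma is_basis_of_span_if_dual_points:
  fixes b :: "'j \<Rightarrow> 'i \<Rightarrow> 'k::field"
  assumes dual: "\<And>i j. b i (p j) = (if i = j then d j else 0)" and d: "\<And>j. d j \<noteq> 0"
  shows "is_basis_of fscale I b (fs.span (b ` I))"
proof -
  have inj: "inj b"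
  proof (rule injI)
    fix i j assume "b i = b j"
    then have "b i (p j) = b j (p j)" by simp
    then show "i = j" using dual[of i j] dual[of j j] d[of j] by (auto split: if_splits)
  qed
  have "fs.independent (b ` I)"
  proof (subst fs.independent_explicit_module, intro allI impI)
    fix t u and v :: "'i \<Rightarrow> 'k"
    assume t: "finite t" "t \<subseteq> b ` I" and z: "(\<Sum>w\<in>t. fscale (u w) w) = 0" and v: "v \<in> t"
    obtain j where j: "v = b j" using t(2) v by blast
    have "(\<Sum>w\<in>t. fscale (u w) w) q = (\<Sum>w\<in>t. u w * w q)" for q
      using t(1) by (induction t rule: finite_induct) (auto simp: fscale_def)
    then have "(\<Sum>w\<in>t. u w * w (p j)) = 0" using z by (metis zero_fun_apply)
    moreover have "(\<Sum>w\<in>t. u w * w (p j)) = (\<Sum>w\<in>t. if w = v then u v * d j else 0)"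
    proof (rule sum.cong[OF refl])
      fix w assume "w \<in> t"
      then obtain i where "w = b i" using t(2) by blast
      then show "u w * w (p j) = (if w = v then u v * d j else 0)"
        using inj by (auto simp: j dual inj_eq)
    qed
    ultimately show "u v = 0" using t(1) v d[of j] by (simp add: sum.delta)
  qed
  then show ?thesis using inj_on_subset[OF inj] by (simp add: is_basis_of_def)
qed

lemma span_image_fscale:
  fixes b :: "'j \<Rightarrow> 'i \<Rightarrow> 'k::field"
  assumes "\<And>j. c j \<noteq> 0"
  shows "fs.span ((\<lambda>j. fscale (c j) (b j)) ` I) = fs.span (b ` I)"
proof (rule antisym)
  show "fs.span ((\<lambda>j. fscale (c j) (b j)) ` I) \<subseteq> fs.span (b ` I)"
    by (intro fs.span_minimal) (auto intro: fs.span_scale[OF fs.span_base])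
  have "b j \<in> fs.span ((\<lambda>j. fscale (c j) (b j)) ` I)" if "j \<in> I" for j
  proof -
    have "fscale (inverse (c j)) (fscale (c j) (b j)) \<in> fs.span ((\<lambda>j. fscale (c j) (b j)) ` I)"
      using that by (intro fs.span_scale fs.span_base) auto
    then show ?thesis using assms by (simp add: fs.scale_scale)
  qed
  then show "fs.span (b ` I) \<subseteq> fs.span ((\<lambda>j. fscale (c j) (b j)) ` I)"
    by (intro fs.span_minimal) auto
qed

section \<open>The Faa di Bruno Lie algebra\<close>

lemma fdb_bracket_left:
  "fdb_bracket (g + g') h = fdb_bracket g h + fdb_bracket g' h"
  "fdb_bracket (fscale c g) h = fscale c (fdb_bracket g h)"
  by (auto simp: fdb_bracket_def fscale_def fun_eq_iff algebra_simps sum.distrib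
      sum_subtractf sum_distrib_left)

lemma fdb_bracket_right:
  "fdb_bracket h (g + g') = fdb_bracket h g + fdb_bracket h g'"
  "fdb_bracket h (fscale c g) = fscale c (fdb_bracket h g)"
  by (auto simp: fdb_bracket_def fscale_def fun_eq_iff algebra_simps sum.distrib
      sum_subtractf sum_distrib_left)

lemma fdb_bracket_zero [simp]: "fdb_bracket 0 h = 0" "fdb_bracket h 0 = 0"
  by (auto simp: fdb_bracket_def)

text \<open>Reverse the convolution sum, \<open>k \<mapsto> n - k\<close>.\<close>

lemma fdb_bracket_antisym: "fdb_bracket h g = - fdb_bracket g h"
proof
  fix n
  have "fdb_bracket h g n = (\<Sum>k\<le>n. (of_nat (n - k) - of_nat (n - (n - k))) * (h (n - k) * g (n - (n - k))))"
    unfolding fdb_bracket_def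
    by (rule sum.reindex_bij_witness[of _ "\<lambda>k. n - k" "\<lambda>k. n - k"]) auto
  also have "\<dots> = (\<Sum>k\<le>n. - ((of_nat k - of_nat (n - k)) * (g k * h (n - k))))"
    by (rule sum.cong) (auto simp: algebra_simps)
  finally show "fdb_bracket h g n = (- fdb_bracket g h) n"
    by (simp add: fdb_bracket_def sum_negf)
qed

lemma fdb_bracket_self: "fdb_bracket g g = (0 :: nat \<Rightarrow> 'k::field_char_0)"
proof
  fix n
  have "fdb_bracket g g n + fdb_bracket g g n = 0"
    using fun_cong[OF fdb_bracket_antisym[of g g], of n] by (simp only: uminus_apply eq_neg_iff_add_eq_0)
  then have "2 * fdb_bracket g g n = 0" by (simp only: mult_2)
  then show "fdb_bracket g g n = 0 n" by simp
qed

lemma fdb_bracket_closed: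
  fixes g h :: "nat \<Rightarrow> 'k::field"
  assumes "g \<in> faa_di_bruno" "h \<in> faa_di_bruno"
  shows "fdb_bracket g h \<in> faa_di_bruno"
proof -
  have e: "fdb_bracket (fdb_e k) h \<in> faa_di_bruno" if "k \<ge> 1" for k
    using assms(2) unfolding faa_di_bruno_def
  proof (induction rule: fs.span_induct)
    case base
    show ?case
      by (auto simp: fs.subspace_def fdb_bracket_right fs.span_zero intro: fs.span_add fs.span_scale)
  next
    case (step w)
    then obtain l where "w = fdb_e l" by blast
    moreover have "(fdb_e (k + l) :: nat \<Rightarrow> 'k) \<in> fs.span (fdb_e ` {1..})"
      using that by (intro fs.span_base) auto
    ultimately show ?case by (simp add: fdb_bracket_e fs.span_scale)
  qed
  show ?thesis
    using assms(1) unfolding faa_di_bruno_def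
  proof (induction rule: fs.span_induct)
    case base
    show ?case
      by (auto simp: fs.subspace_def fdb_bracket_left fs.span_zero intro: fs.span_add fs.span_scale)
  next
    case (step w)
    then show ?case using e by (auto simp: faa_di_bruno_def)
  qed
qed

text \<open>
  The Jacobi expression is trilinear, so the basis suffices. There it is \<open>e\<^bsub>l+m+n\<^esub>\<close> times the cyclic
  sum of \<open>(m - n)(l - m - n)\<close>, which vanishes. Its cyclic symmetry reduces the extension from the
  basis to linearity in the first argument, used three times.
\<close>

lemma fdb_jacobi:
  fixes g h k :: "nat \<Rightarrow> 'k::field"
  assumes "g \<in> faa_di_bruno" "h \<in> faa_di_bruno" "k \<in> faa_di_bruno"
  shows "fdb_bracket g (fdb_bracket h k) + fdb_bracket h (fdb_bracket k g) +
    fdb_bracket k (fdb_bracket g h) = 0"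
proof -
  define J :: "(nat \<Rightarrow> 'k) \<Rightarrow> (nat \<Rightarrow> 'k) \<Rightarrow> (nat \<Rightarrow> 'k) \<Rightarrow> nat \<Rightarrow> 'k"
    where "J a b c = fdb_bracket a (fdb_bracket b c) + fdb_bracket b (fdb_bracket c a) +
      fdb_bracket c (fdb_bracket a b)" for a b c
  have cyc: "J a b c = J b c a" for a b c
    by (simp add: J_def ac_simps)
  have J_add: "J (a + a') b c = J a b c + J a' b c" for a a' b c
    by (simp add: J_def fdb_bracket_left fdb_bracket_right ac_simps)
  have J_scale: "J (fscale t a) b c = fscale t (J a b c)" for t a b c
    by (simp add: J_def fdb_bracket_left fdb_bracket_right fs.scale_right_distrib)
  have J_zero: "J 0 b c = 0" for b c
    by (simp add: J_def)
  have extend: "J a b c = 0"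
    if "\<And>i. J (fdb_e i) b c = 0" "a \<in> faa_di_bruno" for a b c
    using that(2) unfolding faa_di_bruno_def
  proof (induction rule: fs.span_induct)
    case base
    show ?case by (simp add: fs.subspace_def J_add J_scale J_zero flip: zero_fun_def)
  next
    case (step w)
    then show ?case using that(1) by auto
  qed
  have "J (fdb_e l) (fdb_e m) (fdb_e n) = 0" for l m n
    by (simp add: J_def fdb_bracket_e fdb_bracket_right)
      (auto simp: fun_eq_iff fscale_def fdb_e_def algebra_simps)
  then have "J g (fdb_e m) (fdb_e n) = 0" for m n
    using assms(1) by (rule extend)
  then have "J (fdb_e m) (fdb_e n) g = 0" for m n
    using cyc[of g "fdb_e m" "fdb_e n"] by simp
  then have "J h (fdb_e n) g = 0" for n
    using assms(2) by (rule extend)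
  then have "J (fdb_e n) g h = 0" for n
    using cyc[of h "fdb_e n" g] by simp
  then have "J k g h = 0"
    using assms(3) by (rule extend)
  then show ?thesis by (simp add: J_def ac_simps)
qed

lemma lie_algebra_fdb:
  "lie_algebra_on fscale (faa_di_bruno :: (nat \<Rightarrow> 'k::field_char_0) set) fdb_bracket"
  unfolding lie_algebra_on_def
proof (intro conjI ballI allI)
  show "fs.subspace (faa_di_bruno :: (nat \<Rightarrow> 'k) set)"
    by (simp add: faa_di_bruno_def)
qed (simp_all add: fs.vector_space_axioms fdb_bracket_closed fdb_jacobi fdb_bracket_left
    fdb_bracket_right fdb_bracket_self)

section \<open>Transport of Lie structures\<close>

text \<open>
  Each Lie axiom in \<open>S\<close> is an equation between elements of \<open>S\<close>, and \<open>T\<close> maps it to the same axiom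
  in \<open>S'\<close>. As \<open>T\<close> is injective on \<open>S\<close>, the axiom follows.
\<close>

lemma lie_isomorphic_if_bracket_hom:
  assumes lin: "Vector_Spaces.linear scale scale' T" and sub: "module.subspace scale S"
    and bij: "bij_betw T S S'" and L': "lie_algebra_on scale' S' br'"
    and closed: "\<And>a b. a \<in> S \<Longrightarrow> b \<in> S \<Longrightarrow> br a b \<in> S"
    and hom: "\<And>a b. a \<in> S \<Longrightarrow> b \<in> S \<Longrightarrow> T (br a b) = br' (T a) (T b)"
  shows "lie_isomorphic scale S br scale' S' br'"
proof -
  interpret vector_space_pair scale scale'
    using lin by (auto simp: Vector_Spaces.linear_iff vector_space_pair_def)
  have T: "T (a + b) = T a + T b" "T (scale t a) = scale' t (T a)" for a b t
    using lin by (auto simp: Vector_Spaces.linear_iff)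
  have T0: "T 0 = 0" using lin by (rule linear_0)
  have S: "0 \<in> S" "a \<in> S \<Longrightarrow> b \<in> S \<Longrightarrow> a + b \<in> S" "a \<in> S \<Longrightarrow> scale t a \<in> S" for a b t
    using sub by (auto simp: vs1.subspace_def)
  have S': "T a \<in> S'" if "a \<in> S" for a
    using bij that by (auto simp: bij_betw_def)
  have eqI: "a = b" if "T a = T b" "a \<in> S" "b \<in> S" for a b
    using bij that by (auto simp: bij_betw_def inj_on_def)
  have "lie_algebra_on scale S br"
    unfolding lie_algebra_on_def
    by (intro conjI ballI allI vs1.vector_space_axioms sub closed; (assumption | rule eqI)?;
        insert L'; simp add: lie_algebra_on_def T T0 S S' hom closed)
  then show ?thesis
    unfolding lie_isomorphic_def using L' bij T hom by blast
qed

section \<open>Powers of one letter\<close>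

text \<open>The form \<open>g \<otimes> \<dots> \<otimes> g\<close> with \<open>k\<close> factors, extended by \<open>0\<close> to the other tensor degrees.\<close>

definition power_form :: "('v \<Rightarrow> 'k::field) \<Rightarrow> nat \<Rightarrow> 'v list \<Rightarrow> 'k"
  where "power_form g k u = (if length u = k then prod_list (map g u) else 0)"

context vector_space
begin

lemma linear_form_one_at:
  assumes "x \<noteq> 0"
  obtains g where "Vector_Spaces.linear scale (*) g" "g x = 1"
proof -
  interpret VK: vector_space_pair scale "(*) :: 'a \<Rightarrow> 'a \<Rightarrow> 'a"
    by (rule vector_space_pair.intro[OF vector_space_axioms field_vector_space])
  have "independent {x}" using assms by simp
  from VK.linear_independent_extend[OF this, of "\<lambda>_. 1"] show ?thesis
    using that by auto
qed

lemma multilinear_power_form: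
  assumes "Vector_Spaces.linear scale (*) g"
  shows "multilinear scale (*) (power_form g k)"
  using assms by (auto simp: multilinear_def Vector_Spaces.linear_iff power_form_def algebra_simps)

lemma power_word_power_form:
  assumes "Vector_Spaces.linear scale (*) g" "g x = 1"
  shows "power_word scale x j (power_form g k) = (if j = k then 1 else 0)"
  using assms by (simp add: power_word_def word_def multilinear_power_form power_form_def
      map_replicate prod_list_replicate)

lemma power_word_in_tensor_space: "power_word scale x k \<in> tensor_space scale"
  by (auto simp: power_word_def tensor_space_def intro: fs.span_base)

text \<open>
  The weight \<open>h\<close> is arbitrary because the recursion prefixes a letter to the summands: the induction
  hypothesis is applied to \<open>h\<close> precomposed with this prefixing. The counts add up by Pascal's rule.
\<close>

lemma sum_list_shuffle_words_power:
  "(\<Sum>w\<leftarrow>shuffle_words (replicate k x) (replicate l x). h w) =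
     of_nat ((k + l) choose k) * (h (replicate (k + l) x) :: 'a)"
proof (induction "k + l" arbitrary: k l h)
  case 0
  then show ?case by simp
next
  case (Suc n)
  show ?case
  proof (cases k)
    case 0
    then show ?thesis by simp
  next
    case k: (Suc k')
    show ?thesis
    proof (cases l)
      case 0
      then show ?thesis by (simp add: k)
    next
      case l: (Suc l')
      have "n = k' + Suc l'" "n = Suc k' + l'" using Suc(2) k l by auto
      from Suc(1)[OF this(1), of "\<lambda>w. h (x # w)"] Suc(1)[OF this(2), of "\<lambda>w. h (x # w)"]
      show ?thesis by (simp add: k l o_def algebra_simps)
    qed
  qed
qed

text \<open>
  The recursion splits the sum for \<open>x\<^sup>k\<^sup>+\<^sup>1 \<bullet> x\<^sup>l\<close> into \<open>x(x\<^sup>k \<bullet> x\<^sup>l)\<close> and \<open>f x\<close> in front of the shuffles of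
  \<open>x\<^sup>k\<close> and \<open>x\<^sup>l\<close>; the counts \<open>k + l\<close> choose \<open>k - 1\<close> and \<open>k + l\<close> choose \<open>k\<close> combine by Pascal's rule.
  Multilinearity of \<open>h\<close> pulls \<open>\<lambda>\<close> out of the letter \<open>f x\<close>.
\<close>

lemma sum_list_prelie_words_power:
  assumes f: "f x = scale lam x" and "multilinear scale (*) h"
  shows "(\<Sum>w\<leftarrow>prelie_words f (replicate k x) (replicate l x). h w) =
     lam * (if k = 0 then 0 else of_nat ((k + l) choose (k - 1))) * h (replicate (k + l) x)"
  using assms(2)
proof (induction k arbitrary: h)
  case 0
  then show ?case by simp
next
  case (Suc k)
  have "h ([] @ scale lam x # u) = lam * h ([] @ x # u)" for u
    using Suc.prems unfolding multilinear_def Vector_Spaces.linear_iff by blast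
  then have fx: "h (f x # u) = lam * h (x # u)" for u by (simp add: f)
  have "(\<Sum>w\<leftarrow>prelie_words f (replicate (Suc k) x) (replicate l x). h w) =
      lam * (if k = 0 then 0 else of_nat ((k + l) choose (k - 1))) * h (x # replicate (k + l) x) +
      of_nat ((k + l) choose k) * (lam * h (x # replicate (k + l) x))"
    using Suc.IH[OF multilinear_cons[OF Suc.prems, of x]]
      sum_list_shuffle_words_power[of "\<lambda>w. lam * h (x # w)" k x l]
    by (simp add: o_def fx)
  also have "\<dots> = lam * of_nat (Suc (k + l) choose k) * h (x # replicate (k + l) x)"
    by (cases k) (simp_all add: algebra_simps)
  finally show ?case by simp
qed

lemma prelie_prod_power_word:
  assumes "Vector_Spaces.linear scale scale f" and "f x = scale lam x"
  shows "prelie_prod scale f (power_word scale x k) (power_word scale x l) =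
    fscale (lam * (if k = 0 then 0 else of_nat ((k + l) choose (k - 1)))) (power_word scale x (k + l))"
proof
  fix \<phi> :: "'b list \<Rightarrow> 'a"
  have "(\<Sum>w\<leftarrow>ws. word scale w) \<phi> = (\<Sum>w\<leftarrow>ws. word scale w \<phi>)" for ws
    by (induction ws) auto
  then have "prelie_prod scale f (power_word scale x k) (power_word scale x l) \<phi> =
    (\<Sum>w\<leftarrow>prelie_words f (replicate k x) (replicate l x). word scale w \<phi>)"
    by (simp only: power_word_def prelie_prod_word[OF assms(1)])
  then show "prelie_prod scale f (power_word scale x k) (power_word scale x l) \<phi> =
    fscale (lam * (if k = 0 then 0 else of_nat ((k + l) choose (k - 1)))) (power_word scale x (k + l)) \<phi>"
    using sum_list_prelie_words_power[of f x lam \<phi> k l] assms(2)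
    by (cases "multilinear scale (*) \<phi>") (simp_all add: power_word_def word_def fscale_def)
qed

lemma prelie_bracket_add_left:
  assumes "Vector_Spaces.linear scale scale f"
    and "a \<in> tensor_space scale" "a' \<in> tensor_space scale" "b \<in> tensor_space scale"
  shows "prelie_bracket scale f (a + a') b = prelie_bracket scale f a b + prelie_bracket scale f a' b"
  using prelie_prod_right(1)[OF assms(1,4,2,3)]
  by (simp add: prelie_bracket_def prelie_prod_def bilinear_extension_left)

lemma prelie_bracket_scale_left:
  assumes "Vector_Spaces.linear scale scale f"
    and "a \<in> tensor_space scale" "b \<in> tensor_space scale"
  shows "prelie_bracket scale f (fscale c a) b = fscale c (prelie_bracket scale f a b)"
  using prelie_prod_right(2)[OF assms(1,3,2,2)]
  by (simp add: prelie_bracket_def prelie_prod_def bilinear_extension_left fs.scale_right_diff_distrib)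

lemma prelie_bracket_antisym: "prelie_bracket scale f b a = - prelie_bracket scale f a b"
  by (simp add: prelie_bracket_def)

end

section \<open>Isomorphism with the Faa di Bruno algebra\<close>

text \<open>
  For \<open>k \<ge> 1\<close>, with the binomial coefficient written as \<open>(k+l)!/((k-1)!(l+1)!)\<close>, the factor \<open>(l+1)!\<close> of \<open>y\<^sub>l\<close> cancels
  and \<open>(k+1)!/(k-1)!\<close> leaves \<open>k(k+1)\<close>; rewriting \<open>(k+l)!\<close> as \<open>(k+l+1)!/(k+l+1)\<close> produces \<open>y\<^bsub>k+l\<^esub>\<close>.
\<close>

lemma prelie_prod_scaled_power_word:
  fixes scale :: "'k::field_char_0 \<Rightarrow> 'v::ab_group_add \<Rightarrow> 'v"
  assumes V: "vector_space scale" and f: "Vector_Spaces.linear scale scale f"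
    and x: "f x = scale lam x" and lam: "lam \<noteq> 0"
  shows "prelie_prod scale f (scaled_power_word scale lam x k) (scaled_power_word scale lam x l) =
    fscale (of_nat (k * (k + 1)) / of_nat (k + l + 1)) (scaled_power_word scale lam x (k + l))"
proof -
  interpret vector_space scale by fact
  note t = power_word_in_tensor_space
  have coeff: "fact (k + 1) / lam * (fact (l + 1) / lam *
      (lam * (if k = 0 then 0 else of_nat ((k + l) choose (k - 1))))) =
    of_nat (k * (k + 1)) / of_nat (k + l + 1) * (fact (k + l + 1) / lam)"
  proof (cases k)
    case 0
    then show ?thesis by simp
  next
    case (Suc j)
    have "of_nat ((k + l) choose j) = (fact (k + l) / (fact j * fact (l + 1)) :: 'k)"
      using binomial_fact[of j "k + l", where 'a = 'k] by (simp add: Suc)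
    then have "of_nat ((k + l) choose j) * (fact j * fact (l + 1)) = (fact (k + l) :: 'k)"
      by (simp del: fact_Suc)
    moreover have "(fact (k + 1) :: 'k) = of_nat (k * (k + 1)) * fact j"
      by (simp add: Suc algebra_simps)
    moreover have "(fact (k + l + 1) :: 'k) = of_nat (k + l + 1) * fact (k + l)"
      by (simp add: algebra_simps)
    moreover have "(of_nat (k + l + 1) :: 'k) \<noteq> 0"
      by (metis Suc_eq_plus1 of_nat_eq_0_iff nat.simps(3))
    ultimately show ?thesis using lam Suc by (simp add: field_simps del: fact_Suc of_nat_add of_nat_mult of_nat_Suc)
  qed
  have "prelie_prod scale f (scaled_power_word scale lam x k) (scaled_power_word scale lam x l) =
    fscale (fact (k + 1) / lam) (fscale (fact (l + 1) / lam)
      (prelie_prod scale f (power_word scale x k) (power_word scale x l)))"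
    using prelie_prod_right(2)[OF f t t t]
    by (simp add: scaled_power_word_def prelie_prod_def bilinear_extension_left)
  then show ?thesis
    by (simp only: prelie_prod_power_word[OF f x] scaled_power_word_def fs.scale_scale coeff)
qed

lemma prelie_bracket_scaled_power_word:
  fixes scale :: "'k::field_char_0 \<Rightarrow> 'v::ab_group_add \<Rightarrow> 'v"
  assumes "vector_space scale" "Vector_Spaces.linear scale scale f"
    and "f x = scale lam x" "lam \<noteq> 0"
  shows "prelie_bracket scale f (scaled_power_word scale lam x k) (scaled_power_word scale lam x l) =
    fscale (of_nat k - of_nat l) (scaled_power_word scale lam x (k + l))"
proof -
  have "(of_nat (k + l + 1) :: 'k) \<noteq> 0"
    by (metis Suc_eq_plus1 of_nat_eq_0_iff nat.simps(3))
  then have "(of_nat (k * (k + 1)) / of_nat (k + l + 1) - of_nat (l * (l + 1)) / of_nat (k + l + 1) :: 'k) =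
      of_nat k - of_nat l"
    by (subst diff_divide_distrib[symmetric], subst nonzero_divide_eq_eq) (simp_all add: algebra_simps)
  then show ?thesis
    by (simp only: prelie_bracket_def prelie_prod_scaled_power_word[OF assms] add.commute[of l k]
        flip: fs.scale_left_diff_distrib)
qed

text \<open>
  The coordinate map \<open>T\<close> is given by a formula on all functionals on forms, so linearity is immediate;
  injectivity on the span holds because the images
  \<open>e\<^sub>k\<close> of the spanning vectors are independent.
\<close>

lemma lie_isomorphic_powers_fdb:
  fixes scale :: "'k::field_char_0 \<Rightarrow> 'v::ab_group_add \<Rightarrow> 'v"
  assumes V: "vector_space scale" and f: "Vector_Spaces.linear scale scale f"
    and "x \<noteq> 0" and x: "f x = scale lam x" and lam: "lam \<noteq> 0"
  defines "y \<equiv> scaled_power_word scale lam x"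
  shows "lie_isomorphic fscale (fs.span (y ` {1..})) (prelie_bracket scale f)
    fscale (faa_di_bruno :: (nat \<Rightarrow> 'k) set) fdb_bracket"
proof -
  interpret vector_space scale by fact
  obtain g where g: "Vector_Spaces.linear scale (*) g" "g x = 1"
    using linear_form_one_at[OF \<open>x \<noteq> 0\<close>] .
  define S where "S = fs.span (y ` {1..})"
  define T :: "('k, 'v) tensor \<Rightarrow> nat \<Rightarrow> 'k"
    where "T a = (\<lambda>k. lam / fact (k + 1) * a (power_form g k))" for a
  interpret TP: vector_space_pair "fscale :: 'k \<Rightarrow> ('k, 'v) tensor \<Rightarrow> _" "fscale :: 'k \<Rightarrow> (nat \<Rightarrow> 'k) \<Rightarrow> _"
    by unfold_locales
  have T: "T (a + b) = T a + T b" "T (fscale c a) = fscale c (T a)" "T 0 = 0" for a b c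
    by (simp_all add: T_def fscale_def fun_eq_iff distrib_left mult.left_commute del: fact_Suc)
  then have T_lin: "Vector_Spaces.linear fscale fscale T"
    by (simp add: Vector_Spaces.linear_iff fs.vector_space_axioms)
  have Ty: "T (y k) = fdb_e k" for k
    using lam by (auto simp: T_def y_def scaled_power_word_def fscale_def fun_eq_iff fdb_e_def
        power_word_power_form[OF g] simp del: fact_Suc)
  have TyI: "T ` y ` {1..} = fdb_e ` {1..}"
    by (simp add: image_image Ty)
  have inj: "inj_on T S"
    unfolding S_def
  proof (rule TP.linear_inj_on_span_independent_image[OF T_lin])
    show "fs.independent (T ` y ` {1..})"
      unfolding TyI using fdb_basis[where 'k = 'k] by (simp add: is_basis_of_def)
    show "inj_on T (y ` {1..})"
      using fdb_basis[where 'k = 'k] by (auto simp: inj_on_def Ty is_basis_of_def)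
  qed
  have "T ` S = faa_di_bruno"
    unfolding S_def faa_di_bruno_def TP.linear_span_image[OF T_lin, symmetric] TyI ..
  with inj have bij: "bij_betw T S faa_di_bruno"
    by (simp add: bij_betw_def)
  have y_tensor: "y k \<in> tensor_space scale" for k
    using power_word_in_tensor_space[of x k]
    by (simp add: y_def scaled_power_word_def tensor_space_def fs.span_scale)
  have S_tensor: "S \<subseteq> tensor_space scale"
    unfolding S_def by (rule fs.span_minimal) (use y_tensor in \<open>auto simp: tensor_space_def\<close>)
  have S: "0 \<in> S" "a \<in> S \<Longrightarrow> b \<in> S \<Longrightarrow> a + b \<in> S" "a \<in> S \<Longrightarrow> fscale c a \<in> S" for a b c
    by (auto simp: S_def fs.span_zero fs.span_add fs.span_scale)
  \<comment> \<open>Closure and compatibility with \<open>T\<close> are proved together: both are linear in each argument.\<close>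
  define H where "H a b \<longleftrightarrow> prelie_bracket scale f a b \<in> S \<and>
    T (prelie_bracket scale f a b) = fdb_bracket (T a) (T b)" for a b
  \<comment> \<open>Antisymmetry lets one extension lemma, linear in the first argument, serve for both arguments.\<close>
  have H_sym: "H b a" if "H a b" for a b
    using that unfolding H_def prelie_bracket_antisym[of f b a] fdb_bracket_antisym[of "T b" "T a"]
    by (simp add: TP.linear_neg[OF T_lin] S_def fs.span_neg)
  have extend: "H a b" if "\<And>k. k \<ge> 1 \<Longrightarrow> H (y k) b" "a \<in> S" "b \<in> tensor_space scale" for a b
  proof -
    note br = prelie_bracket_add_left[OF f _ _ that(3)] prelie_bracket_scale_left[OF f _ that(3)]
    have "a \<in> S \<and> H a b"
      using that(2) unfolding S_def
    proof (induction rule: fs.span_induct)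
      case base
      have "prelie_bracket scale f 0 b = 0"
        using br(2)[of 0 0] by (simp add: tensor_space_def fs.span_zero)
      moreover have "a \<in> tensor_space scale" if "a \<in> S" for a
        using S_tensor that by blast
      ultimately show ?case
        unfolding S_def[symmetric]
        by (auto simp: fs.subspace_def H_def S T fdb_bracket_left br)
    next
      case (step w)
      then show ?case using that(1) by (auto intro: fs.span_base)
    qed
    then show ?thesis by simp
  qed
  have "H (y k) (y l)" if "k \<ge> 1" for k l
  proof -
    have br: "prelie_bracket scale f (y k) (y l) = fscale (of_nat k - of_nat l) (y (k + l))"
      unfolding y_def by (rule prelie_bracket_scaled_power_word[OF V f x lam])
    have "y (k + l) \<in> S"
      unfolding S_def using that by (intro fs.span_base) auto
    then show ?thesis by (simp add: H_def br S T Ty fdb_bracket_e)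
  qed
  then have "H a (y l)" if "a \<in> S" for a l
    using extend that y_tensor by blast
  then have "H b a" if "a \<in> S" "b \<in> S" for a b
    using extend H_sym that S_tensor by blast
  then show ?thesis
    using T_lin bij lie_algebra_fdb
    by (fold S_def, intro lie_isomorphic_if_bracket_hom[where T = T]) (auto simp: H_def S_def)
qed

theorem mainTheorem13:
  fixes scale :: "'k::field_char_0 \<Rightarrow> 'v::ab_group_add \<Rightarrow> 'v"
    and f :: "'v \<Rightarrow> 'v" and x :: 'v and lam :: 'k
  assumes "vector_space scale"
    and "Vector_Spaces.linear scale scale f"
    and "x \<noteq> 0" and "f x = scale lam x" and "lam \<noteq> 0"
  shows
    "let X = power_word scale x;
         y = scaled_power_word scale lam x;
         Kx = fs.span (range X);
         Kx_plus = fs.span (X ` {1..})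
     in
       is_basis_of fscale UNIV X Kx \<and>
       is_basis_of fscale {1..} X Kx_plus \<and>
       (\<forall>k l. prelie_prod scale f (X k) (X l) =
          fscale (lam * (if k = 0 then 0 else of_nat ((k + l) choose (k - 1)))) (X (k + l))) \<and>
       is_basis_of fscale UNIV y Kx \<and>
       (\<forall>k l. prelie_prod scale f (y k) (y l) =
          fscale (of_nat (k * (k + 1)) / of_nat (k + l + 1)) (y (k + l))) \<and>
       (\<forall>k l. prelie_bracket scale f (y k) (y l) =
          fscale (of_nat k - of_nat l) (y (k + l))) \<and>
       lie_isomorphic fscale Kx_plus (prelie_bracket scale f)
         fscale (faa_di_bruno :: (nat \<Rightarrow> 'k) set) fdb_bracket"
proof -
  interpret vector_space scale by fact
  obtain g where g: "Vector_Spaces.linear scale (*) g" "g x = 1"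
    using linear_form_one_at[OF \<open>x \<noteq> 0\<close>] .
  define X where "X = power_word scale x"
  define y where "y = scaled_power_word scale lam x"
  have c: "fact (k + 1) / lam \<noteq> 0" for k
    using \<open>lam \<noteq> 0\<close> by (simp del: fact_Suc)
  have y: "y = (\<lambda>k. fscale (fact (k + 1) / lam) (X k))"
    by (simp add: y_def X_def scaled_power_word_def fun_eq_iff)
  have span: "fs.span (y ` I) = fs.span (X ` I)" for I
    unfolding y by (rule span_image_fscale[OF c])
  have X_basis: "is_basis_of fscale I X (fs.span (X ` I))" for I
    using power_word_power_form[OF g]
    by (intro is_basis_of_span_if_dual_points[of X "power_form g" "\<lambda>_. 1"]) (simp_all add: X_def)
  have "is_basis_of fscale UNIV y (fs.span (range y))"
    using power_word_power_form[OF g] c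
    by (intro is_basis_of_span_if_dual_points[of y "power_form g" "\<lambda>k. fact (k + 1) / lam"])
      (simp_all add: y X_def fscale_def del: fact_Suc)
  then show ?thesis
    unfolding Let_def X_def[symmetric] y_def[symmetric]
    using X_basis span[of UNIV] span[of "{1..}"]
      prelie_prod_power_word[OF assms(2,4)] prelie_prod_scaled_power_word[OF assms(1,2,4,5)]
      prelie_bracket_scaled_power_word[OF assms(1,2,4,5)] lie_isomorphic_powers_fdb[OF assms]
    by (simp add: X_def y_def)
qed

end
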